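(* Let $\mathcal{S}$ be a set system, let $\eta : \mathcal{S} \to \mathbb{N}^+$, let $P$ be a finite pot with $\bigcup \mathcal{S} \subseteq P$ and $|P| \geq \sum_{S \in \mathcal{S}} \eta(S)$, and let $t \in \{1, \ldots, |\mathcal{S}|-1\}$. Then Fixer has a winning strategy against Breaker $\mathfrak{B}_t$ in the $\eta$-game described below if and only if \[\Big|\bigcup \mathcal{W}\Big| \geq \sum_{W \in \mathcal{W}} \eta(W) - \nu_t(\mathcal{W}) \quad\text{for every } \mathcal{W} \subseteq \mathcal{S}.\]
   Context: A set system is a finite family of finite sets; members are treated as indexed positions (and $\eta$ is attached to positions, so it is unchanged when a member is modified). An $\eta$-transversal of $\mathcal{S}$ is a function $f$ assigning to each $S\in\mathcal{S}$ a subset $f(S) \subseteq S$ with $|f(S)| = \eta(S)$, such that $f(A) \cap f(B) = \emptyset$ for distinct members $A,B$. The $\eta$-game is played by Fixer and Breaker on the current set system with fixed pot $P\supseteq\bigcup\mathcal{S}$; players alternate, Fixer first. Fixer's move: pick $x \in P$ and a member $S$ with $x \notin S$, and replace $S$ by $(S \cup \{x\}) \setminus \{y\}$ for some $y \in S$. Breaker $\mathfrak{B}_t$'s reply: if Fixer modified $S$ by inserting $x$ and removing $y$, Breaker may pick at most $t$ members other than $S$ and modify each by swapping $x$ for $y$ or $y$ for $x$. Fixer wins iff he can (after finitely many rounds) bring the set system to a state that has an $\eta$-transversal; otherwise Breaker wins. For $\mathcal{W}\subseteq\mathcal{S}$, $d_{\mathcal{W}}(x) := |\{S \in \mathcal{W}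 : x \in S\}|$ and \[\nu_t(\mathcal{W}) := \sum_{x \in \bigcup \mathcal{W}} \left\lfloor \frac{d_{\mathcal{W}}(x) - 1}{t+1} \right\rfloor.\] *)

theory Defs
  imports Main "HOL-Library.Disjoint_Sets"
begin

text \<open>
  A set system is a family \<open>S :: 'i \<Rightarrow> 'a set\<close> indexed by a finite set \<open>I\<close> of positions; two
  positions may carry equal sets. The demand \<open>\<eta> :: 'i \<Rightarrow> nat\<close> is attached to positions, so it
  does not change when the players modify the sets. Values of \<open>S\<close> outside \<open>I\<close> are irrelevant,
  and no move changes them.
\<close>

definition eta_transversal ::
    "'i set \<Rightarrow> ('i \<Rightarrow> nat) \<Rightarrow> ('i \<Rightarrow> 'a set) \<Rightarrow> ('i \<Rightarrow> 'a set) \<Rightarrow> bool" where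
  "eta_transversal I \<eta> S f \<longleftrightarrow>
     (\<forall>i\<in>I. f i \<subseteq> S i \<and> card (f i) = \<eta> i) \<and> disjoint_family_on f I"

definition has_transversal :: "'i set \<Rightarrow> ('i \<Rightarrow> nat) \<Rightarrow> ('i \<Rightarrow> 'a set) \<Rightarrow> bool" where
  "has_transversal I \<eta> S \<longleftrightarrow> (\<exists>f. eta_transversal I \<eta> S f)"

text \<open>A move \<open>(i, x, y)\<close> of Fixer inserts \<open>x\<close> into the member at position \<open>i\<close> and removes \<open>y\<close>.\<close>

definition legal_fix ::
    "'i set \<Rightarrow> 'a set \<Rightarrow> ('i \<Rightarrow> 'a set) \<Rightarrow> 'i \<times> 'a \<times> 'a \<Rightarrow> bool" where
  "legal_fix I P S m \<longleftrightarrow> (case m of (i, x, y) \<Rightarrow> i \<in> I \<and> x \<in> P \<and> x \<notin> S i \<and> y \<in> S i)"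

definition apply_fix :: "('i \<Rightarrow> 'a set) \<Rightarrow> 'i \<times> 'a \<times> 'a \<Rightarrow> ('i \<Rightarrow> 'a set)" where
  "apply_fix S m = (case m of (i, x, y) \<Rightarrow> S(i := (S i \<union> {x}) - {y}))"

definition swapped :: "'a \<Rightarrow> 'a \<Rightarrow> 'a set \<Rightarrow> 'a set \<Rightarrow> bool" where
  "swapped x y T T' \<longleftrightarrow>
     (x \<in> T \<and> y \<notin> T \<and> T' = (T - {x}) \<union> {y}) \<or>
     (y \<in> T \<and> x \<notin> T \<and> T' = (T - {y}) \<union> {x})"

text \<open>
  \<open>breaker_reply I t m S S'\<close>: \<open>S\<close> is the system just after Fixer made the move \<open>m\<close>, and Breaker
  may reply by turning it into \<open>S'\<close>. Choosing \<open>J = {}\<close> means that Breaker changes nothing.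
\<close>

definition breaker_reply ::
    "'i set \<Rightarrow> nat \<Rightarrow> 'i \<times> 'a \<times> 'a \<Rightarrow> ('i \<Rightarrow> 'a set) \<Rightarrow> ('i \<Rightarrow> 'a set) \<Rightarrow> bool" where
  "breaker_reply I t m S S' \<longleftrightarrow> (case m of (i, x, y) \<Rightarrow>
     (\<exists>J. J \<subseteq> I - {i} \<and> card J \<le> t \<and>
          (\<forall>j\<in>J. swapped x y (S j) (S' j)) \<and> (\<forall>j. j \<notin> J \<longrightarrow> S' j = S j)))"

text \<open>
  A history is the nonempty list of the systems at the ends of the rounds played so far, starting
  with the initial system. Fixer's strategy \<open>\<sigma>\<close> maps histories to moves. The predicate
  \<open>play I \<eta> P t S \<sigma> h\<close> says that \<open>h\<close> can arise from the initial system \<open>S\<close> when Fixer follows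
  \<open>\<sigma>\<close>. The game stops once a system at the end of a round (or the initial system) has a
  transversal; a transversal that exists only before Breaker's reply does not count.
\<close>

inductive play ::
    "'i set \<Rightarrow> ('i \<Rightarrow> nat) \<Rightarrow> 'a set \<Rightarrow> nat \<Rightarrow> ('i \<Rightarrow> 'a set) \<Rightarrow>
     (('i \<Rightarrow> 'a set) list \<Rightarrow> 'i \<times> 'a \<times> 'a) \<Rightarrow> ('i \<Rightarrow> 'a set) list \<Rightarrow> bool"
  for I \<eta> P t S \<sigma> where
  start: "play I \<eta> P t S \<sigma> [S]"
| round: "play I \<eta> P t S \<sigma> h \<Longrightarrow> \<not> has_transversal I \<eta> (last h) \<Longrightarrow>
          legal_fix I P (last h) (\<sigma> h) \<Longrightarrow>
          breaker_reply I t (\<sigma> h) (apply_fix (last h) (\<sigma> h)) S' \<Longrightarrow>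
          play I \<eta> P t S \<sigma> (h @ [S'])"

text \<open>
  A strategy wins if it always supplies a legal move while there is no transversal, and no play
  goes on forever; thus every play ends, after finitely many rounds, in a system that has a
  transversal. If Fixer is stuck without a transversal, he loses.
\<close>

definition winning_strategy ::
    "'i set \<Rightarrow> ('i \<Rightarrow> nat) \<Rightarrow> 'a set \<Rightarrow> nat \<Rightarrow> ('i \<Rightarrow> 'a set) \<Rightarrow>
     (('i \<Rightarrow> 'a set) list \<Rightarrow> 'i \<times> 'a \<times> 'a) \<Rightarrow> bool" where
  "winning_strategy I \<eta> P t S \<sigma> \<longleftrightarrow>
     (\<forall>h. play I \<eta> P t S \<sigma> h \<and> \<not> has_transversal I \<eta> (last h) \<longrightarrow>
          legal_fix I P (last h) (\<sigma> h)) \<and>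
     \<not> (\<exists>p :: nat \<Rightarrow> 'i \<Rightarrow> 'a set. \<forall>n. play I \<eta> P t S \<sigma> (map p [0..<Suc n]))"

definition fixer_wins ::
    "'i set \<Rightarrow> ('i \<Rightarrow> nat) \<Rightarrow> 'a set \<Rightarrow> nat \<Rightarrow> ('i \<Rightarrow> 'a set) \<Rightarrow> bool" where
  "fixer_wins I \<eta> P t S \<longleftrightarrow> (\<exists>\<sigma>. winning_strategy I \<eta> P t S \<sigma>)"

definition deg :: "('i \<Rightarrow> 'a set) \<Rightarrow> 'i set \<Rightarrow> 'a \<Rightarrow> nat" where
  "deg S W x = card {i \<in> W. x \<in> S i}"

text \<open>
  For finite \<open>W\<close> every \<open>x\<close> in the range of summation has degree at least 1, so the natural-number
  subtraction is exact; \<open>div\<close> is the floor of the quotient.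
\<close>

definition nu :: "nat \<Rightarrow> ('i \<Rightarrow> 'a set) \<Rightarrow> 'i set \<Rightarrow> nat" where
  "nu t S W = (\<Sum>x\<in>(\<Union>i\<in>W. S i). (deg S W x - 1) div (t + 1))"

end

(*
  Counting each element x with multiplicity ceil (d_W(x) / (t + 1)), the condition says that W has
  total capacity at least eta(W).

  If some W lacks capacity, Breaker keeps it from growing: a round can only increase it when the
  inserted x gets degree = 1 (mod t + 1) in W. Breaker then either swaps back in another member of W,
  or, if all members of W containing x also contain y, swaps y for x in d_W(y) mod (t + 1) members.

  Conversely, let W maximize the deficiency eta(W) - |U W|, and suppose it is positive. By Hall's
  theorem the other members have a transversal outside U W. If W is not everything, Fixer keeps this
  transversal untouched and plays on W with the remaining pot. If W is everything, some pot element z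
  is unused and some x has degree at least t + 2. Fixer replaces x by z in one member; Breaker can
  then only move x to z in at most t more members, so the union grows by z. Since at most t + 1
  copies of x move, no capacity drops.
*)

theory Submission
  imports Defs
begin

subsection \<open>Hall's theorem with demands\<close>

text \<open>Adding \<open>U\<close> to \<open>W\<close> cannot increase the maximal deficiency, so
  the new elements that \<open>U\<close> contributes must cover all of its demand. This provides
  Hall's condition for the members outside \<open>W\<close>, both for a tight \<open>W\<close> and
  for Fixer's most deficient \<open>W\<close>.\<close>

lemma deficiency_le_diff:
  assumes "finite I" and "\<And>i. i \<in> I \<Longrightarrow> finite (S i)" and "W \<subseteq> I" and "U \<subseteq> I - W"
    and max: "\<And>V. V \<subseteq> I \<Longrightarrow> sum \<eta> V + card (\<Union>(S ` W)) \<le> card (\<Union>(S ` V)) + (sum \<eta> W :: nat)"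
  shows "sum \<eta> U \<le> card (\<Union>i\<in>U. S i - \<Union>(S ` W))"
proof -
  have fin: "finite W" "finite U" using assms finite_subset by blast+
  then have "finite (\<Union>(S ` W))" "finite (\<Union>(S ` (U \<union> W)))" using assms(2-4) by auto
  note fin = fin this
  have "sum \<eta> (U \<union> W) = sum \<eta> U + sum \<eta> W"
    using fin assms(4) by (intro sum.union_disjoint) auto
  moreover have "sum \<eta> (U \<union> W) + card (\<Union>(S ` W)) \<le> card (\<Union>(S ` (U \<union> W))) + sum \<eta> W"
    using assms by (intro max) auto
  moreover have "card (\<Union>(S ` (U \<union> W)) - \<Union>(S ` W)) = card (\<Union>(S ` (U \<union> W))) - card (\<Union>(S ` W))"
    using fin by (intro card_Diff_subset) auto
  moreover have "(\<Union>i\<in>U. S i - \<Union>(S ` W)) = \<Union>(S ` (U \<union> W)) - \<Union>(S ` W)"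
    by auto
  ultimately show ?thesis by simp
qed

lemma has_transversal_split:
  assumes "W \<subseteq> I" and "has_transversal W \<eta> S"
    and "has_transversal (I - W) \<eta> (\<lambda>i. S i - \<Union>(S ` W))"
  shows "has_transversal I \<eta> S"
proof -
  obtain f g where f: "eta_transversal W \<eta> S f"
    and g: "eta_transversal (I - W) \<eta> (\<lambda>i. S i - \<Union>(S ` W)) g"
    using assms unfolding has_transversal_def by blast
  have "eta_transversal I \<eta> S (\<lambda>i. if i \<in> W then f i else g i)"
    using f g unfolding eta_transversal_def disjoint_family_on_def
    by (auto; blast)
  thus ?thesis unfolding has_transversal_def by blast
qed

text \<open>Induction on the total demand. A tight subfamily with a proper, nonzero part of the
  demand is split off. If there is none, every such subfamily has an element to spare, so an element
  \<open>x\<close> may be reserved for some \<open>i\<close> whose demand then drops by one.\<close>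

theorem Hall_demands:
  assumes "finite I" and "\<And>i. i \<in> I \<Longrightarrow> finite (S i)"
    and "\<And>W. W \<subseteq> I \<Longrightarrow> sum \<eta> W \<le> card (\<Union>(S ` W))"
  shows "has_transversal I \<eta> S"
  using assms
proof (induction "sum \<eta> I" arbitrary: I \<eta> S rule: less_induct)
  case less
  note fin = less.prems(1,2) and hall = less.prems(3)
  show ?case
  proof (cases "\<exists>W\<subseteq>I. 0 < sum \<eta> W \<and> sum \<eta> W < sum \<eta> I \<and> card (\<Union>(S ` W)) = sum \<eta> W")
    case True
    then obtain W where W: "W \<subseteq> I" "0 < sum \<eta> W" "sum \<eta> W < sum \<eta> I"
      and tight: "card (\<Union>(S ` W)) = sum \<eta> W" by blast
    have rest: "sum \<eta> (I - W) < sum \<eta> I"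
      using W fin by (simp add: sum_diff_nat finite_subset)
    have "has_transversal W \<eta> S"
      by (rule less.hyps) (use W fin hall in \<open>auto intro: finite_subset\<close>)
    moreover have "has_transversal (I - W) \<eta> (\<lambda>i. S i - \<Union>(S ` W))"
    proof (rule less.hyps[OF rest])
      fix U assume "U \<subseteq> I - W"
      \<comment> \<open>A tight \<open>W\<close> has deficiency 0, and Hall's condition makes this
        the maximum.\<close>
      then show "sum \<eta> U \<le> card (\<Union>i\<in>U. S i - \<Union>(S ` W))"
        using fin W(1) hall tight by (intro deficiency_le_diff[of I]) auto
    qed (use fin in auto)
    ultimately show ?thesis using W(1) by (rule has_transversal_split[rotated])
  next
    case no_tight: False
    show ?thesis
    proof (cases "sum \<eta> I = 0")
      case True
      then have "eta_transversal I \<eta> S (\<lambda>_. {})"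
        using fin by (auto simp: eta_transversal_def disjoint_family_on_def)
      thus ?thesis unfolding has_transversal_def by blast
    next
      case False
      then obtain i where i: "i \<in> I" "0 < \<eta> i" using fin by auto
      have "\<eta> i \<le> card (S i)" using hall[of "{i}"] i by simp
      then obtain x where x: "x \<in> S i" using i by fastforce
      define \<theta> where "\<theta> = \<eta>(i := \<eta> i - 1)"
      have \<theta>_in: "sum \<eta> W = Suc (sum \<theta> W)" if "W \<subseteq> I" "i \<in> W" for W
      proof -
        have "finite W" using that fin by (auto intro: finite_subset)
        moreover have "sum \<theta> (W - {i}) = sum \<eta> (W - {i})"
          by (rule sum.cong) (auto simp: \<theta>_def)
        ultimately show ?thesis using that i by (simp add: sum.remove[of W i] \<theta>_def)
      qed
      have \<theta>_notin: "sum \<theta> W = sum \<eta> W" if "i \<notin> W" for W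
        using that by (intro sum.cong) (auto simp: \<theta>_def)
      have "has_transversal I \<theta> (\<lambda>j. S j - {x})"
      proof (rule less.hyps)
        show "sum \<theta> I < sum \<eta> I" using \<theta>_in i by simp
      next
        fix W assume W: "W \<subseteq> I"
        have eq: "(\<Union>j\<in>W. S j - {x}) = \<Union>(S ` W) - {x}" by auto
        have finU: "finite (\<Union>(S ` W))" using W fin by (auto intro: finite_subset)
        have "card (\<Union>(S ` W)) - 1 \<le> card (\<Union>(S ` W) - {x})"
          using finU by (simp add: card_Diff_singleton_if)
        \<comment> \<open>The loss of \<open>x\<close> is paid for by the lowered demand if
          \<open>i\<close> is in \<open>W\<close>. Otherwise \<open>W\<close> misses the positive
          demand of \<open>i\<close>, so it has demand 0 or is not tight.\<close>
        moreover have "sum \<theta> W \<le> card (\<Union>(S ` W)) - 1"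
        proof (cases "i \<in> W")
          case True
          then show ?thesis using \<theta>_in[OF W] hall[OF W] by simp
        next
          case False
          have "sum \<eta> W < sum \<eta> I"
            using W False i fin by (intro sum_strict_mono2[of I W i]) auto
          then show ?thesis using \<theta>_notin[OF False] hall[OF W] no_tight W
            by (cases "sum \<eta> W = 0") (auto simp: le_less)
        qed
        ultimately show "sum \<theta> W \<le> card (\<Union>j\<in>W. S j - {x})" unfolding eq by linarith
      qed (use fin in auto)
      then obtain f where f: "eta_transversal I \<theta> (\<lambda>j. S j - {x}) f"
        unfolding has_transversal_def by blast
      have "finite (f i)" "x \<notin> f i"
        using f fin i unfolding eta_transversal_def by (auto intro: finite_subset[of "f i" "S i"])
      then have "eta_transversal I \<eta> S (f(i := insert x (f i)))"
        using f i x unfolding eta_transversal_def disjoint_family_on_def \<theta>_def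
        by (auto; blast)
      thus ?thesis unfolding has_transversal_def by blast
    qed
  qed
qed

subsection \<open>Capacities\<close>

text \<open>The ceiling of \<open>d / (t + 1)\<close>.\<close>

definition capacity :: "nat \<Rightarrow> nat \<Rightarrow> nat" where
  "capacity t d = (d + t) div (t + 1)"

text \<open>Summing over the fixed pot keeps the index set stable while the union changes; elements
  of degree 0 contribute nothing.\<close>

definition total_capacity :: "nat \<Rightarrow> 'a set \<Rightarrow> ('i \<Rightarrow> 'a set) \<Rightarrow> 'i set \<Rightarrow> nat" where
  "total_capacity t P S W = (\<Sum>x\<in>P. capacity t (deg S W x))"

lemma capacity_0 [simp]: "capacity t 0 = 0"
  by (simp add: capacity_def)

lemma capacity_pos: "0 < d \<Longrightarrow> capacity t d = 1 + (d - 1) div (t + 1)"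
  using div_add_self2[of "t + 1" "d - 1"] by (cases d) (simp_all add: capacity_def)

lemma capacity_mono: "d \<le> e \<Longrightarrow> capacity t d \<le> capacity t e"
  by (simp add: capacity_def div_le_mono)

lemma capacity_split:
  assumes "s \<le> d" "s \<le> t + 1"
  shows "capacity t d \<le> capacity t (d - s) + capacity t s"
proof (cases "s = 0")
  case False
  have "capacity t d \<le> capacity t (d - s + (t + 1))"
    using assms by (intro capacity_mono) simp
  also have "\<dots> = capacity t (d - s) + 1"
    using div_add_self2[of "t + 1" "d - s + t"] by (simp add: capacity_def ac_simps)
  also have "1 = capacity t s"
    using False assms by (simp add: capacity_pos)
  finally show ?thesis .
qed simp

lemma deg_pos_iff: "finite W \<Longrightarrow> 0 < deg S W x \<longleftrightarrow> x \<in> \<Union>(S ` W)"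
  by (auto simp: deg_def card_gt_0_iff)

text \<open>For positive \<open>d\<close> the ceiling of d/(t+1) is 1 + floor((d-1)/(t+1)): the ones
  count the union, the floors add up to \<open>nu\<close>.\<close>

lemma total_capacity_eq:
  assumes "finite P" "finite W" "\<Union>(S ` W) \<subseteq> P"
  shows "total_capacity t P S W = card (\<Union>(S ` W)) + nu t S W"
proof -
  have "total_capacity t P S W = (\<Sum>x\<in>\<Union>(S ` W). capacity t (deg S W x))"
    unfolding total_capacity_def
  proof (rule sum.mono_neutral_right[OF assms(1,3)], rule)
    fix x assume "x \<in> P - \<Union>(S ` W)"
    then have "deg S W x = 0" using deg_pos_iff[OF assms(2), of S x] by auto
    then show "capacity t (deg S W x) = 0" by simp
  qed
  also have "\<dots> = (\<Sum>x\<in>\<Union>(S ` W). 1 + (deg S W x - 1) div (t + 1))"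
    using deg_pos_iff[OF assms(2), of S] by (intro sum.cong capacity_pos) simp_all
  finally show ?thesis by (simp add: nu_def sum.distrib flip: One_nat_def)
qed

lemma card_Union_le_total_capacity:
  assumes "finite P" "finite W" "\<Union>(S ` W) \<subseteq> P"
  shows "card (\<Union>(S ` W)) \<le> total_capacity t P S W"
  using total_capacity_eq[OF assms] by simp

section \<open>Exchanging one element for another in several members\<close>

definition move :: "'i set \<Rightarrow> 'a \<Rightarrow> 'a \<Rightarrow> ('i \<Rightarrow> 'a set) \<Rightarrow> ('i \<Rightarrow> 'a set)" where
  "move K x y S = (\<lambda>j. if j \<in> K then S j - {x} \<union> {y} else S j)"

text \<open>The order of the two elements is reversed: a triple of the game inserts its first
  element, whereas \<open>move\<close> removes its first.\<close>

lemma apply_fix_eq_move: "x \<noteq> y \<Longrightarrow> apply_fix S (i, x, y) = move {i} y x S"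
  by (auto simp: apply_fix_def move_def fun_eq_iff)

lemma deg_move:
  assumes "finite W" "x \<noteq> y" "\<And>j. j \<in> K \<inter> W \<Longrightarrow> x \<in> S j \<and> y \<notin> S j"
  shows "deg (move K x y S) W x = deg S W x - card (K \<inter> W)"
    and "card (K \<inter> W) \<le> deg S W x"
    and "deg (move K x y S) W y = deg S W y + card (K \<inter> W)"
    and "z \<noteq> x \<Longrightarrow> z \<noteq> y \<Longrightarrow> deg (move K x y S) W z = deg S W z"
proof -
  have "{i \<in> W. x \<in> move K x y S i} = {i \<in> W. x \<in> S i} - K \<inter> W"
    using assms by (auto simp: move_def)
  moreover have sub: "K \<inter> W \<subseteq> {i \<in> W. x \<in> S i}" using assms by auto
  ultimately show "deg (move K x y S) W x = deg S W x - card (K \<inter> W)"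
    using assms(1) by (simp add: deg_def card_Diff_subset)
  show "card (K \<inter> W) \<le> deg S W x"
    using sub assms(1) by (auto simp: deg_def intro: card_mono)
  have "{i \<in> W. y \<in> move K x y S i} = {i \<in> W. y \<in> S i} \<union> K \<inter> W"
    using assms by (auto simp: move_def)
  moreover have "{i \<in> W. y \<in> S i} \<inter> (K \<inter> W) = {}" using assms by auto
  ultimately show "deg (move K x y S) W y = deg S W y + card (K \<inter> W)"
    using assms(1) by (simp add: deg_def card_Un_disjoint)
  show "deg (move K x y S) W z = deg S W z" if "z \<noteq> x" "z \<noteq> y"
  proof -
    have "{i \<in> W. z \<in> move K x y S i} = {i \<in> W. z \<in> S i}"
      using that by (auto simp: move_def)
    then show ?thesis by (simp add: deg_def)
  qed
qed

lemma total_capacity_le_iff: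
  assumes "finite P" "x \<in> P" "y \<in> P" "x \<noteq> y"
    and "\<And>z. z \<noteq> x \<Longrightarrow> z \<noteq> y \<Longrightarrow> deg S' W z = deg S W z"
  shows "total_capacity t P S' W \<le> total_capacity t P S W \<longleftrightarrow>
    capacity t (deg S' W x) + capacity t (deg S' W y)
      \<le> capacity t (deg S W x) + capacity t (deg S W y)"
proof -
  have *: "total_capacity t P R W = capacity t (deg R W x) + (capacity t (deg R W y)
      + (\<Sum>z\<in>P - {x} - {y}. capacity t (deg R W z)))" for R :: "'b \<Rightarrow> 'a set"
    unfolding total_capacity_def using assms(1-4) by (simp add: sum.remove[of P x] sum.remove[of "P - {x}" y])
  have "(\<Sum>z\<in>P - {x} - {y}. capacity t (deg S' W z)) = (\<Sum>z\<in>P - {x} - {y}. capacity t (deg S W z))"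
    using assms(5) by (intro sum.cong) auto
  then show ?thesis unfolding * by simp
qed

subsection \<open>Breaker\<close>

text \<open>Here \<open>a\<close> is the degree of the inserted element before Fixer's move and
  \<open>b\<close> that of the removed one after it. A gain forces \<open>a\<close> to be a multiple
  of \<open>t + 1\<close>. Moving the remainder of \<open>b\<close> over then adds at most
  \<open>t\<close> to \<open>Suc a\<close>, which does not raise its ceiling, and lowers
  \<open>b\<close> to a multiple of \<open>t + 1\<close>, whose ceiling is one below that of
  \<open>Suc b\<close>.\<close>

lemma breaker_numeric:
  assumes "capacity t a + capacity t (Suc b) < capacity t (Suc a) + capacity t b" and "a \<le> b"
  shows "b mod (t + 1) \<le> b - a"
    and "capacity t (Suc a + b mod (t + 1)) + capacity t (b - b mod (t + 1))
      \<le> capacity t a + capacity t (Suc b)"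
proof -
  define k s q r where "k = a div (t + 1)" and "s = a mod (t + 1)"
    and "q = b div (t + 1)" and "r = b mod (t + 1)"
  then have a: "a = k * (t + 1) + s" "s < t + 1" and b: "b = q * (t + 1) + r" "r < t + 1"
    by (simp_all only: div_mult_mod_eq mod_less_divisor add_gr_0 zero_less_one disj_absorb simp_thms)
  have cap: "capacity t (n * (t + 1) + m) = n + capacity t m" for n m
    unfolding capacity_def add.assoc by (subst div_mult_self3) simp_all
  have cap1: "capacity t m = 1" if "0 < m" "m \<le> t + 1" for m
    using that by (simp add: capacity_pos)
  have ca: "capacity t (Suc a) = k + 1"
    using cap[of k "Suc s"] cap1[of "Suc s"] a by simp
  have cb: "capacity t (Suc b) = q + 1"
    using cap[of q "Suc r"] cap1[of "Suc r"] b by simp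
  have s: "s = 0"
  proof (rule ccontr)
    assume "s \<noteq> 0"
    then have "capacity t a = k + 1" using cap[of k s] cap1[of s] a by simp
    then show False using assms(1) ca capacity_mono[of b "Suc b" t] by simp
  qed
  have r: "b mod (t + 1) = r" by (simp only: \<open>r = b mod (t + 1)\<close>)
  have "k * (t + 1) < (q + 1) * (t + 1)" using assms(2) a b by simp
  then have "k \<le> q" by (simp only: mult_less_cancel2) simp
  then have "k * (t + 1) \<le> q * (t + 1)" by (rule mult_le_mono1)
  then show "b mod (t + 1) \<le> b - a" unfolding r using a b s by linarith
  have "capacity t (Suc a + r) = k + 1"
    using cap[of k "Suc r"] cap1[of "Suc r"] a s b by simp
  moreover have "capacity t (b - r) = q" using cap[of q 0] b by simp
  moreover have "capacity t a = k" using cap[of k 0] a s by simp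
  ultimately show "capacity t (Suc a + b mod (t + 1)) + capacity t (b - b mod (t + 1))
      \<le> capacity t a + capacity t (Suc b)" unfolding r cb by simp
qed

lemma breaker_reply_exists:
  assumes "finite I" "W \<subseteq> I" "finite P" "0 < t" and SP: "\<Union>(S ` W) \<subseteq> P"
    and legal: "legal_fix I P S m"
  shows "\<exists>S'. breaker_reply I t m (apply_fix S m) S' \<and> \<Union>(S' ` W) \<subseteq> P \<and>
    total_capacity t P S' W \<le> total_capacity t P S W"
proof -
  obtain i x y where m: "m = (i, x, y)" by (cases m)
  have i: "i \<in> I" "x \<in> P" "x \<notin> S i" "y \<in> S i" and xy: "x \<noteq> y"
    using legal by (auto simp: m legal_fix_def)
  define T where "T = move {i} y x S"
  have T: "apply_fix S m = T" using xy by (simp add: m T_def apply_fix_eq_move)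
  have finW: "finite W" using assms by (auto intro: finite_subset)
  have pass: "breaker_reply I t m T T"
    unfolding breaker_reply_def m by (auto intro!: exI[of _ "{}"])
  show ?thesis
  proof (cases "i \<in> W")
    case False
    then have eq: "T j = S j" if "j \<in> W" for j using that by (auto simp: T_def move_def)
    then have "deg T W z = deg S W z" for z unfolding deg_def by (metis (no_types, lifting))
    then have "total_capacity t P T W = total_capacity t P S W"
      by (simp add: total_capacity_def)
    moreover have "\<Union>(T ` W) \<subseteq> P" using eq SP by auto
    ultimately show ?thesis using pass T by auto
  next
    case iW: True
    have yP: "y \<in> P" using iW i SP by auto
    have iW': "{i} \<inter> W = {i}" using iW by auto
    have TP: "\<Union>(T ` W) \<subseteq> P" using SP i by (auto simp: T_def move_def split: if_splits)
    have dT: "deg T W y = deg S W y - 1" "1 \<le> deg S W y" "deg T W x = deg S W x + 1"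
      "\<And>z. z \<noteq> x \<Longrightarrow> z \<noteq> y \<Longrightarrow> deg T W z = deg S W z"
      using deg_move[OF finW, of y x "{i}" S] xy i by (auto simp: T_def iW')
    \<comment> \<open>Since \<open>i\<close> lacks \<open>x\<close> before the move and
      \<open>y\<close> after it, both numbers count members of \<open>W\<close> other than
      \<open>i\<close>.\<close>
    define a b where "a = deg S W x" and "b = deg T W y"
    have a: "deg T W x = Suc a" and b: "deg S W y = Suc b" using dT by (auto simp: a_def b_def)
    have goal: ?thesis
      if "breaker_reply I t m T S'" "\<Union>(S' ` W) \<subseteq> P"
        "\<And>z. z \<noteq> x \<Longrightarrow> z \<noteq> y \<Longrightarrow> deg S' W z = deg T W z"
        "capacity t (deg S' W x) + capacity t (deg S' W y) \<le> capacity t a + capacity t (Suc b)" for S'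
      using that total_capacity_le_iff[OF assms(3) i(2) yP xy, of S' W S t] dT T
      by (auto simp flip: a_def b)
    \<comment> \<open>Breaker passes if Fixer gained nothing. He undoes both degree changes in
      another member \<open>j\<close> if one has \<open>x\<close> but not \<open>y\<close>. In the
      last case the members with \<open>x\<close> are among those with \<open>y\<close>, as
      \<open>breaker_numeric\<close> requires.\<close>
    consider "capacity t (Suc a) + capacity t b \<le> capacity t a + capacity t (Suc b)"
      | j where "j \<in> W" "j \<noteq> i" "x \<in> S j" "y \<notin> S j"
      | "capacity t a + capacity t (Suc b) < capacity t (Suc a) + capacity t b"
        "\<And>j. j \<in> W \<Longrightarrow> j \<noteq> i \<Longrightarrow> x \<in> S j \<Longrightarrow> y \<in> S j"
      by (meson not_le)
    then show ?thesis
    proof cases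
      case 1
      show ?thesis by (rule goal[OF pass TP]) (use 1 a b_def in auto)
    next
      case (2 j)
      define S' where "S' = move {j} x y T"
      have jW: "{j} \<inter> W = {j}" using 2 by auto
      have Tj: "x \<in> T j" "y \<notin> T j" using 2 by (auto simp: T_def move_def)
      have d: "deg S' W x = deg T W x - 1" "deg S' W y = deg T W y + 1"
        "\<And>z. z \<noteq> x \<Longrightarrow> z \<noteq> y \<Longrightarrow> deg S' W z = deg T W z"
        using deg_move[OF finW xy, of "{j}" T] Tj by (auto simp: S'_def jW)
      have "breaker_reply I t m T S'"
        unfolding breaker_reply_def m prod.case
        by (rule exI[of _ "{j}"]) (use 2 Tj assms in \<open>auto simp: S'_def move_def swapped_def\<close>)
      moreover have "\<Union>(S' ` W) \<subseteq> P" using TP yP by (auto simp: S'_def move_def split: if_splits)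
      ultimately show ?thesis by (rule goal) (use d a b_def in auto)
    next
      case 3
      define X where "X = {j \<in> W. j \<noteq> i \<and> x \<in> S j}"
      define Y where "Y = {j \<in> W. j \<noteq> i \<and> y \<in> S j}"
      have "{j \<in> W. x \<in> S j} = X" "{j \<in> W. y \<in> T j} = Y"
        using i xy by (auto simp: X_def Y_def T_def move_def)
      then have card: "card X = a" "card Y = b" by (auto simp: a_def b_def deg_def)
      have XY: "X \<subseteq> Y" and finY: "finite Y" using 3 finW by (auto simp: X_def Y_def)
      then have "a \<le> b" using card by (metis card_mono)
      note num = breaker_numeric[OF 3(1) this]
      \<comment> \<open>Exactly the members in \<open>Y - X\<close> allow \<open>y\<close> to be
        swapped for \<open>x\<close>; the first part of \<open>breaker_numeric\<close> says that
        there are enough of them.\<close>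
      have "card (Y - X) = b - a" using card XY finY by (simp add: card_Diff_subset finite_subset)
      then obtain J where J: "J \<subseteq> Y - X" "card J = b mod (t + 1)"
        using num(1) by (metis obtain_subset_with_card_n)
      define S' where "S' = move J y x T"
      have JW: "J \<inter> W = J" using J by (auto simp: Y_def)
      have TJ: "y \<in> T j \<and> x \<notin> T j" if "j \<in> J" for j
        using J that by (auto simp: T_def move_def X_def Y_def)
      have d: "deg S' W y = deg T W y - card J" "deg S' W x = deg T W x + card J"
        "\<And>z. z \<noteq> x \<Longrightarrow> z \<noteq> y \<Longrightarrow> deg S' W z = deg T W z"
        using deg_move[OF finW, of y x J T] TJ xy unfolding S'_def JW by auto
      have "breaker_reply I t m T S'"
        unfolding breaker_reply_def m prod.case
      proof (intro exI[of _ J] conjI)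
        show "card J \<le> t" unfolding J using mod_less_divisor[of "t + 1" b] by linarith
        show "J \<subseteq> I - {i}" using J assms(2) by (auto simp: Y_def)
      qed (use TJ in \<open>auto simp: S'_def move_def swapped_def\<close>)
      moreover have "\<Union>(S' ` W) \<subseteq> P" using TP i by (auto simp: S'_def move_def split: if_splits)
      ultimately show ?thesis
        by (rule goal) (use d a num(2) J(2) in \<open>auto simp flip: b_def\<close>)
    qed
  qed
qed

lemma no_transversal:
  assumes "finite P" "finite W" "W \<subseteq> I" "\<Union>(S ` W) \<subseteq> P"
    and "total_capacity t P S W < sum \<eta> W"
  shows "\<not> has_transversal I \<eta> S"
proof
  assume "has_transversal I \<eta> S"
  then obtain f where "eta_transversal I \<eta> S f"
    unfolding has_transversal_def by blast
  then have f: "\<forall>i\<in>W. f i \<subseteq> S i \<and> card (f i) = \<eta> i"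
    and disj: "\<forall>i\<in>W. \<forall>j\<in>W. i \<noteq> j \<longrightarrow> f i \<inter> f j = {}"
    using assms(3) unfolding eta_transversal_def disjoint_family_on_def by (meson subsetD)+
  have finU: "finite (\<Union>(S ` W))" using finite_subset[OF assms(4,1)] .
  have "sum \<eta> W = (\<Sum>i\<in>W. card (f i))" using f by simp
  also have "\<dots> = card (\<Union>(f ` W))"
  proof (rule card_UN_disjoint[symmetric])
    show "\<forall>i\<in>W. finite (f i)" using f finU by (meson UN_upper finite_subset)
  qed (use assms(2) disj in auto)
  also have "\<dots> \<le> card (\<Union>(S ` W))" using f by (intro card_mono[OF finU]) blast
  also have "\<dots> \<le> total_capacity t P S W" using assms by (intro card_Union_le_total_capacity)
  finally show False using assms by simp
qed

text \<open>Lack of capacity in \<open>W\<close> survives every round under Breaker's reply and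
  excludes a transversal, so against any strategy that always moves legally the play never
  ends.\<close>

lemma fixer_loses:
  assumes "finite I" "W \<subseteq> I" "finite P" "0 < t" "\<Union>(S ` W) \<subseteq> P"
    and "total_capacity t P S W < sum \<eta> W"
  shows "\<not> fixer_wins I \<eta> P t S"
proof
  assume "fixer_wins I \<eta> P t S"
  then obtain \<sigma> where
    legal: "\<And>h. play I \<eta> P t S \<sigma> h \<Longrightarrow> \<not> has_transversal I \<eta> (last h) \<Longrightarrow> legal_fix I P (last h) (\<sigma> h)"
    and no_inf: "\<And>p. \<exists>n. \<not> play I \<eta> P t S \<sigma> (map p [0..<Suc n])"
    unfolding fixer_wins_def winning_strategy_def by blast
  define bad where "bad S' \<longleftrightarrow> \<Union>(S' ` W) \<subseteq> P \<and> total_capacity t P S' W < sum \<eta> W" for S'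
  define good where "good h \<longleftrightarrow> play I \<eta> P t S \<sigma> h \<and> bad (last h)" for h
  have finW: "finite W" using assms finite_subset by blast
  have step: "\<exists>S'. good (h @ [S'])" if "good h" for h
  proof -
    have h: "play I \<eta> P t S \<sigma> h" "bad (last h)" using that by (auto simp: good_def)
    then have last: "\<Union>(last h ` W) \<subseteq> P" "total_capacity t P (last h) W < sum \<eta> W"
      by (auto simp: bad_def)
    then have nt: "\<not> has_transversal I \<eta> (last h)"
      using assms(2,3) finW by (intro no_transversal[of P W]) auto
    note lg = legal[OF h(1) nt]
    obtain S' where S': "breaker_reply I t (\<sigma> h) (apply_fix (last h) (\<sigma> h)) S'" "\<Union>(S' ` W) \<subseteq> P"
      "total_capacity t P S' W \<le> total_capacity t P (last h) W"
      using breaker_reply_exists[OF assms(1-4) last(1) lg] by blast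
    then have "bad S'" using last(2) unfolding bad_def by simp
    then show ?thesis using play.round[OF h(1) nt lg S'(1)] by (auto simp: good_def)
  qed
  \<comment> \<open>Each history extends the previous one, so their last entries form one infinite
    play.\<close>
  define H where "H = rec_nat [S] (\<lambda>_ h. h @ [SOME S'. good (h @ [S'])])"
  have good_H: "good (H n)" for n
  proof (induction n)
    case 0
    then show ?case using assms by (auto simp: H_def good_def bad_def intro: play.start)
  next
    case (Suc n)
    then show ?case using someI_ex[OF step[OF Suc]] by (simp add: H_def)
  qed
  have "H n = map (\<lambda>k. last (H k)) [0..<Suc n]" for n
    by (induction n) (simp_all add: H_def)
  then have "play I \<eta> P t S \<sigma> (map (\<lambda>k. last (H k)) [0..<Suc n])" for n
    using good_H[of n] by (simp add: good_def)
  then show False using no_inf by blast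
qed

subsection \<open>Fixer\<close>

text \<open>Replaces strategies on histories by a recursion on the number of rounds left, so that
  games can be combined by induction.\<close>

primrec wins_within ::
    "'i set \<Rightarrow> ('i \<Rightarrow> nat) \<Rightarrow> 'a set \<Rightarrow> nat \<Rightarrow> nat \<Rightarrow> ('i \<Rightarrow> 'a set) \<Rightarrow> bool" where
  "wins_within I \<eta> P t 0 S \<longleftrightarrow> has_transversal I \<eta> S"
| "wins_within I \<eta> P t (Suc n) S \<longleftrightarrow> has_transversal I \<eta> S \<or>
     (\<exists>m. legal_fix I P S m \<and>
       (\<forall>S'. breaker_reply I t m (apply_fix S m) S' \<longrightarrow> wins_within I \<eta> P t n S'))"

lemma wins_within_transversal: "has_transversal I \<eta> S \<Longrightarrow> wins_within I \<eta> P t n S"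
  by (cases n) auto

lemma wins_within_Suc: "wins_within I \<eta> P t n S \<Longrightarrow> wins_within I \<eta> P t (Suc n) S"
  by (induction n arbitrary: S) (simp, fastforce)

lemma wins_within_mono: "wins_within I \<eta> P t n S \<Longrightarrow> n \<le> k \<Longrightarrow> wins_within I \<eta> P t k S"
  by (induction k) (use wins_within_Suc le_Suc_eq in blast)+

lemma wins_within_imp_fixer_wins:
  assumes "wins_within I \<eta> P t N S"
  shows "fixer_wins I \<eta> P t S"
proof -
  \<comment> \<open>A history includes the initial system, so \<open>length h - 1\<close> of the
    \<open>N\<close> rounds are over, and \<open>N - length h\<close> remain after the next
    one.\<close>
  define ok where "ok h m \<longleftrightarrow> legal_fix I P (last h) m \<and>
     (\<forall>S'. breaker_reply I t m (apply_fix (last h) m) S' \<longrightarrow> wins_within I \<eta> P t (N - length h) S')"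
    for h m
  define \<sigma> where "\<sigma> h = (SOME m. ok h m)" for h
  have ok: "ok h (\<sigma> h)"
    if "length h \<le> Suc N" "wins_within I \<eta> P t (Suc N - length h) (last h)" 
      "\<not> has_transversal I \<eta> (last h)" for h
  proof -
    have "\<exists>m. ok h m"
    proof (cases "Suc N - length h")
      case (Suc n)
      then have "n = N - length h" by simp
      then show ?thesis using that Suc unfolding ok_def by auto
    qed (use that in auto)
    then show ?thesis unfolding \<sigma>_def by (rule someI_ex)
  qed
  have inv: "length h \<le> Suc N \<and> wins_within I \<eta> P t (Suc N - length h) (last h)"
    if "play I \<eta> P t S \<sigma> h" for h
    using that
  proof induction
    case start
    then show ?case using assms by simp
  next
    case (round h S')
    have "length h \<noteq> Suc N" using round by auto
    moreover have "wins_within I \<eta> P t (N - length h) S'"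
      using ok[of h] round unfolding ok_def by blast
    ultimately show ?case using round by simp
  qed
  \<comment> \<open>An infinite play would have a prefix that exceeds the length bound
    \<open>Suc N\<close>.\<close>
  have "\<not> play I \<eta> P t S \<sigma> (map p [0..<Suc (Suc N)])" for p
    using inv[of "map p [0..<Suc (Suc N)]"] by auto
  then have "winning_strategy I \<eta> P t S \<sigma>"
    using ok inv unfolding winning_strategy_def ok_def by blast
  then show ?thesis unfolding fixer_wins_def by blast
qed

section \<open>Restricting the game to a subfamily and a smaller pot\<close>

lemma swapped_Diff: "swapped x y T T' \<Longrightarrow> x \<in> P \<Longrightarrow> y \<in> P \<Longrightarrow> T' - P = T - P"
  by (auto simp: swapped_def)

lemma has_transversal_extend:
  assumes "has_transversal W \<eta> R" "\<And>i. i \<in> W \<Longrightarrow> R i = S i" "\<Union>(S ` W) \<subseteq> P'"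
    and "eta_transversal (I - W) \<eta> (\<lambda>i. S i - P') g"
  shows "has_transversal I \<eta> S"
proof -
  obtain f where f: "eta_transversal W \<eta> R f" using assms(1) unfolding has_transversal_def by blast
  have "eta_transversal I \<eta> S (\<lambda>i. if i \<in> W then f i else g i)"
    using f assms(2-) unfolding eta_transversal_def disjoint_family_on_def by (auto; blast)
  then show ?thesis unfolding has_transversal_def by blast
qed

text \<open>
  A transversal of the members outside \<open>W\<close> that avoids the restricted pot \<open>P'\<close> survives every round
  in which only elements of \<open>P'\<close> are exchanged, so Fixer may play on \<open>W\<close> alone.
\<close>

lemma wins_within_extend:
  assumes "wins_within W \<eta> P' t n R" and "finite I" "W \<subseteq> I" "P' \<subseteq> P"
    and "\<And>i. i \<in> W \<Longrightarrow> R i = S i" and "\<Union>(S ` W) \<subseteq> P'"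
    and "eta_transversal (I - W) \<eta> (\<lambda>i. S i - P') g"
  shows "wins_within I \<eta> P t n S"
  using assms
proof (induction n arbitrary: R S)
  case 0
  then show ?case using has_transversal_extend[of W \<eta> R S P' I g] by simp
next
  case (Suc n)
  note prems = Suc.prems
  show ?case
  proof (cases "has_transversal W \<eta> R")
    case True
    then show ?thesis using has_transversal_extend[of W \<eta> R S P' I g] prems
      by (intro wins_within_transversal) blast
  next
    case False
    then obtain m where m: "legal_fix W P' R m"
      "\<And>R'. breaker_reply W t m (apply_fix R m) R' \<Longrightarrow> wins_within W \<eta> P' t n R'"
      using prems(1) by auto
    obtain i x y where mi: "m = (i, x, y)" by (cases m)
    have i: "i \<in> W" "x \<in> P'" "x \<notin> R i" "y \<in> R i" using m(1) by (auto simp: mi legal_fix_def)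
    have yP: "y \<in> P'" using i prems by auto
    have "legal_fix I P S m" using i prems by (auto simp: mi legal_fix_def)
    moreover have "wins_within I \<eta> P t n S'" if S': "breaker_reply I t m (apply_fix S m) S'" for S'
    proof -
      obtain J where J: "J \<subseteq> I - {i}" "card J \<le> t"
        "\<And>j. j \<in> J \<Longrightarrow> swapped x y (apply_fix S m j) (S' j)"
        "\<And>j. j \<notin> J \<Longrightarrow> S' j = apply_fix S m j"
        using S' unfolding breaker_reply_def mi by auto
      have outside: "S' j - P' = S j - P'" if "j \<notin> W" for j
      proof -
        have "apply_fix S m j = S j" using that i(1) by (auto simp: mi apply_fix_def)
        then show ?thesis
          using swapped_Diff[OF J(3) i(2) yP] J(4) by (cases "j \<in> J") simp_all
      qed
      have inside: "S' j \<subseteq> P'" if "j \<in> W" for j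
      proof -
        have "S j \<subseteq> P'" using prems(6) that by auto
        then have "apply_fix S m j \<subseteq> P'" using i(2) by (auto simp: mi apply_fix_def)
        then have "apply_fix S m j - P' = {}" by simp
        then show ?thesis
          using swapped_Diff[OF J(3) i(2) yP] J(4) by (cases "j \<in> J") auto
      qed
      have agree: "apply_fix R m j = apply_fix S m j" if "j \<in> W" for j
        using prems(5) that i(1) by (simp add: mi apply_fix_def)
      \<comment> \<open>Breaker may also have swapped outside \<open>W\<close>, which a reply in the
        game on \<open>W\<close> does not allow. Hence \<open>R'\<close> takes over his changes on
        \<open>W\<close> only, and the induction needs two systems that agree just on
        \<open>W\<close>.\<close>
      define R' where "R' j = (if j \<in> W then S' j else R j)" for j
      have "card (J \<inter> W) \<le> card J" using J(1) prems(2) by (meson card_mono finite_Diff finite_subset inf_le1)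
      then have "breaker_reply W t m (apply_fix R m) R'"
        unfolding breaker_reply_def mi prod.case
      proof (intro exI[of _ "J \<inter> W"] conjI ballI allI impI)
        show "J \<inter> W \<subseteq> W - {i}" using J(1) by auto
        show "card (J \<inter> W) \<le> t" using \<open>card (J \<inter> W) \<le> card J\<close> J(2) by simp
        show "swapped x y (apply_fix R (i, x, y) j) (R' j)" if "j \<in> J \<inter> W" for j
          using J(3)[of j] agree that by (simp add: R'_def mi)
        show "R' j = apply_fix R (i, x, y) j" if "j \<notin> J \<inter> W" for j
          using J(4)[of j] agree[of j] that i(1) by (cases "j \<in> W") (auto simp: R'_def mi apply_fix_def)
      qed
      then have "wins_within W \<eta> P' t n R'" by (rule m(2))
      moreover have "eta_transversal (I - W) \<eta> (\<lambda>i. S' i - P') g"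
        using prems(7) outside unfolding eta_transversal_def by auto
      moreover have "R' j = S' j" if "j \<in> W" for j using that by (simp add: R'_def)
      moreover have "\<Union>(S' ` W) \<subseteq> P'" using inside by auto
      ultimately show ?thesis using prems(2-4) by (intro Suc.IH)
    qed
    ultimately show ?thesis unfolding wins_within.simps by blast
  qed
qed

section \<open>Fixer's win in boundedly many rounds\<close>

lemma max_deficient:
  assumes "finite I" and "\<not> sum \<eta> V \<le> card (\<Union>(S ` V))" and "V \<subseteq> I"
  shows "\<exists>W\<subseteq>I. card (\<Union>(S ` W)) < (sum \<eta> W :: nat) \<and>
    (\<forall>V\<subseteq>I. sum \<eta> V + card (\<Union>(S ` W)) \<le> card (\<Union>(S ` V)) + sum \<eta> W)"
proof -
  \<comment> \<open>Integers, since deficiencies may be negative.\<close>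
  define \<delta> where "\<delta> V = int (sum \<eta> V) - int (card (\<Union>(S ` V)))" for V
  have "Max (\<delta> ` Pow I) \<in> \<delta> ` Pow I" using assms(1) by (intro Max_in) auto
  then obtain W where W: "W \<subseteq> I" "\<delta> W = Max (\<delta> ` Pow I)" by auto
  have max: "\<delta> V \<le> \<delta> W" if "V \<subseteq> I" for V
    unfolding W(2) using that assms(1) by (intro Max_ge) auto
  show ?thesis
  proof (intro exI[of _ W] conjI allI impI W(1))
    show "card (\<Union>(S ` W)) < sum \<eta> W" using max[OF assms(3)] assms(2) unfolding \<delta>_def by linarith
    show "sum \<eta> V + card (\<Union>(S ` W)) \<le> card (\<Union>(S ` V)) + sum \<eta> W" if "V \<subseteq> I" for V
      using max[OF that] unfolding \<delta>_def by linarith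
  qed
qed

text \<open>The round bound is also the induction measure. Passing to a proper subfamily lowers the
  product by at least \<open>card P + 1\<close>, which outweighs any loss in the size of the union;
  on the full family each round enlarges the union by one.\<close>

lemma fixer_wins_within:
  assumes "finite I" "finite P" "\<Union>(S ` I) \<subseteq> P" "sum \<eta> I \<le> card P"
    and "\<And>W. W \<subseteq> I \<Longrightarrow> sum \<eta> W \<le> total_capacity t P S W"
  shows "wins_within I \<eta> P t (card I * (card P + 1) - card (\<Union>(S ` I))) S"
  using assms
proof (induction "card I * (card P + 1) - card (\<Union>(S ` I))" arbitrary: I P S rule: less_induct)
  case less
  note fin = less.prems(1,2) and SP = less.prems(3) and pot = less.prems(4) and cond = less.prems(5)
  have finS: "finite (S i)" if "i \<in> I" for i using that SP fin by (meson UN_subset_iff finite_subset)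
  define n where "n = card I * (card P + 1) - card (\<Union>(S ` I))"
  have leP: "card (\<Union>(S ` I)) \<le> card P" using SP fin by (intro card_mono)
  show ?case
  proof (cases "has_transversal I \<eta> S")
    case True
    then show ?thesis by (rule wins_within_transversal)
  next
    case no_tr: False
    have "\<exists>V\<subseteq>I. \<not> sum \<eta> V \<le> card (\<Union>(S ` V))"
    proof (rule ccontr)
      assume "\<not> ?thesis"
      then have "has_transversal I \<eta> S" using fin(1) finS by (intro Hall_demands) auto
      then show False using no_tr by simp
    qed
    then obtain V where V: "V \<subseteq> I" "\<not> sum \<eta> V \<le> card (\<Union>(S ` V))" by blast
    obtain W where W: "W \<subseteq> I" "card (\<Union>(S ` W)) < sum \<eta> W" and
      max: "\<And>V. V \<subseteq> I \<Longrightarrow> sum \<eta> V + card (\<Union>(S ` W)) \<le> card (\<Union>(S ` V)) + sum \<eta> W"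
      using max_deficient[OF fin(1) V(2,1)] by blast
    have finW: "finite W" using W fin finite_subset by blast
    show ?thesis
    proof (cases "W = I")
      case False
      have "has_transversal (I - W) \<eta> (\<lambda>i. S i - \<Union>(S ` W))"
        using fin finS W(1) max by (intro Hall_demands deficiency_le_diff[of I]) auto
      then obtain g where g: "eta_transversal (I - W) \<eta> (\<lambda>i. S i - \<Union>(S ` W)) g"
        unfolding has_transversal_def by blast
      \<comment> \<open>The elements of the outer transversal are withdrawn from the pot. They
        number \<open>sum \<eta> I - sum \<eta> W\<close>, so the remaining pot still covers the
        demand of \<open>W\<close>.\<close>
      define Q where "Q = \<Union>(g ` (I - W))"
      define P' where "P' = P - Q"
      have g': "g i \<subseteq> S i - \<Union>(S ` W)" "card (g i) = \<eta> i" if "i \<in> I - W" for i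
        using g that unfolding eta_transversal_def by auto
      have QP: "Q \<subseteq> P" using g' SP unfolding Q_def by blast
      have WP': "\<Union>(S ` W) \<subseteq> P'" using g'(1) SP W(1) unfolding P'_def Q_def by blast
      have gP': "eta_transversal (I - W) \<eta> (\<lambda>i. S i - P') g"
        using g unfolding eta_transversal_def P'_def Q_def by auto
      have "card Q = (\<Sum>i\<in>I - W. card (g i))"
        unfolding Q_def using fin g'(1) finS g unfolding eta_transversal_def disjoint_family_on_def
        by (intro card_UN_disjoint) (auto intro: finite_subset)
      also have "\<dots> = sum \<eta> I - sum \<eta> W"
        using g'(2) W finW by (simp add: sum_diff_nat)
      finally have cQ: "card Q = sum \<eta> I - sum \<eta> W" .
      have P': "card P' = card P - card Q" "finite P'" "card P' \<le> card P"
        using QP fin unfolding P'_def by (auto simp: card_Diff_subset finite_subset card_mono)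
      have potW: "sum \<eta> W \<le> card P'" unfolding P'(1) cQ
        using pot sum_mono2[OF fin(1) W(1), of \<eta>] by simp
      have "card W < card I" using W False fin by (simp add: psubset_card_mono)
      then have "Suc (card W) * (card P + 1) \<le> card I * (card P + 1)" by (intro mult_le_mono1) simp
      moreover have "card W * (card P' + 1) \<le> card W * (card P + 1)"
        using P' by (intro mult_le_mono2) simp
      ultimately have less_n: "card W * (card P' + 1) - card (\<Union>(S ` W)) < n"
        unfolding n_def mult_Suc using leP by linarith
      have "sum \<eta> U \<le> total_capacity t P' S U" if U: "U \<subseteq> W" for U
      proof -
        have "\<Union>(S ` U) \<subseteq> P'" "\<Union>(S ` U) \<subseteq> P" "finite U"
          using U WP' finW P'_def by (auto intro: finite_subset)
        then have "total_capacity t P' S U = total_capacity t P S U"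
          using P'(2) fin by (simp add: total_capacity_eq)
        then show ?thesis using cond[of U] U W by simp
      qed
      then have "wins_within W \<eta> P' t (card W * (card P' + 1) - card (\<Union>(S ` W))) S"
        using less_n finW P' WP' potW unfolding n_def by (intro less.hyps) auto
      then have "wins_within I \<eta> P t (card W * (card P' + 1) - card (\<Union>(S ` W))) S"
        by (rule wins_within_extend) (use fin W WP' P'_def gP' in auto)
      then show ?thesis using less_n unfolding n_def by (rule wins_within_mono[OF _ less_imp_le])
    next
      case True
      then have lt: "card (\<Union>(S ` I)) < sum \<eta> I" using W by simp
      then have "\<Union>(S ` I) \<noteq> P" using pot by auto
      then obtain z where z: "z \<in> P" "z \<notin> \<Union>(S ` I)" using SP by blast
      \<comment> \<open>If all degrees were at most \<open>t + 1\<close>, then \<open>nu\<close>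
        would vanish and the capacity would be the size of the union, which is below the
        demand.\<close>
      have "\<exists>x\<in>\<Union>(S ` I). t + 1 < deg S I x"
      proof (rule ccontr)
        assume "\<not> ?thesis"
        then have "(deg S I x - 1) div (t + 1) = 0" if "x \<in> \<Union>(S ` I)" for x
          using that by (intro div_less) (fastforce simp: not_less)
        then have "nu t S I = 0" unfolding nu_def by (intro sum.neutral) blast
        then show False using lt cond[of I] total_capacity_eq[OF fin(2,1) SP, of t] by simp
      qed
      then obtain x i where x: "i \<in> I" "x \<in> S i" "t + 1 < deg S I x" by blast
      have xz: "x \<noteq> z" and xP: "x \<in> P" using x z SP by auto
      have n_pos: "Suc (card (\<Union>(S ` I))) \<le> card I * (card P + 1)"
      proof -
        have "1 * (card P + 1) \<le> card I * (card P + 1)"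
          using x(1) fin by (intro mult_le_mono1) (auto simp: Suc_le_eq card_gt_0_iff)
        then show ?thesis using leP by simp
      qed
      then obtain k where k: "n = Suc k" unfolding n_def by (metis Suc_diff_Suc Suc_le_lessD)
      have "legal_fix I P S (i, z, x)" using x z by (auto simp: legal_fix_def)
      moreover have "wins_within I \<eta> P t k S'"
        if S': "breaker_reply I t (i, z, x) (apply_fix S (i, z, x)) S'" for S'
      proof -
        obtain J where J: "J \<subseteq> I - {i}" "card J \<le> t"
          "\<And>j. j \<in> J \<Longrightarrow> swapped z x (apply_fix S (i, z, x) j) (S' j)"
          "\<And>j. j \<notin> J \<Longrightarrow> S' j = apply_fix S (i, z, x) j"
          using S' unfolding breaker_reply_def by auto
        \<comment> \<open>After Fixer's move \<open>z\<close> occurs only in member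
          \<open>i\<close>, so each of Breaker's swaps replaces \<open>x\<close> by
          \<open>z\<close>. The whole round is thus one \<open>move\<close> on
          \<open>K\<close>.\<close>
        define K where "K = insert i J"
        have KI: "K \<subseteq> I" using J x by (auto simp: K_def)
        have "finite J" using J(1) fin finite_subset by auto
        then have cardK: "card K \<le> t + 1" using J(2) by (simp add: K_def card_insert_if)
        have app: "apply_fix S (i, z, x) j = S j" if "j \<noteq> i" for j using that by (simp add: apply_fix_def)
        have zj: "z \<notin> S j" if "j \<in> I" for j using z that by auto
        have inK: "x \<in> S j \<and> z \<notin> S j" if "j \<in> K" for j
        proof (cases "j = i")
          case False
          then have "j \<in> J" "j \<in> I" using that J by (auto simp: K_def)
          then show ?thesis using J(3)[of j] app[OF False] zj[of j] by (auto simp: swapped_def)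
        qed (use x zj in auto)
        have S'_eq: "S' = move K x z S"
        proof
          fix j
          show "S' j = move K x z S j"
          proof (cases "j \<in> J")
            case True
            then have "j \<noteq> i" "j \<in> K" using J by (auto simp: K_def)
            then show ?thesis using J(3)[OF True] app inK[of j] by (auto simp: swapped_def move_def)
          next
            case False
            then show ?thesis using J(4)[OF False] xz
              by (auto simp: K_def move_def apply_fix_def)
          qed
        qed
        have degs: "deg S' U x = deg S U x - card (K \<inter> U)" "card (K \<inter> U) \<le> deg S U x"
          "deg S' U z = card (K \<inter> U)" "\<And>y. y \<noteq> x \<Longrightarrow> y \<noteq> z \<Longrightarrow> deg S' U y = deg S U y"
          if "U \<subseteq> I" for U
        proof -
          have finU: "finite U" using that fin finite_subset by blast
          then have "deg S U z = 0" using deg_pos_iff[of U S z] z that by auto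
          then show "deg S' U x = deg S U x - card (K \<inter> U)" "card (K \<inter> U) \<le> deg S U x"
          "deg S' U z = card (K \<inter> U)" "\<And>y. y \<noteq> x \<Longrightarrow> y \<noteq> z \<Longrightarrow> deg S' U y = deg S U y"
            unfolding S'_eq using deg_move[OF finU xz, of K S] inK by auto
        qed
        have cond': "sum \<eta> U \<le> total_capacity t P S' U" if U: "U \<subseteq> I" for U
        proof -
          have "card (K \<inter> U) \<le> card K"
            using KI fin by (intro card_mono) (auto intro: finite_subset)
          then have "capacity t (deg S U x) \<le> capacity t (deg S' U x) + capacity t (deg S' U z)"
            using degs[OF U] cardK capacity_split[of "card (K \<inter> U)" "deg S U x" t] by simp
          moreover have "deg S U z = 0" using deg_pos_iff[of U S z] z U fin finite_subset by blast
          ultimately have "total_capacity t P S U \<le> total_capacity t P S' U"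
            using total_capacity_le_iff[OF fin(2) xP z(1) xz, of S U S' t] degs(4)[OF U] by auto
          then show ?thesis using cond[OF U] by simp
        qed
        have KI': "K \<inter> I = K" using KI by auto
        have "card (K \<inter> I) \<le> t + 1" using cardK KI' by simp
        \<comment> \<open>At least \<open>t + 2\<close> members had \<open>x\<close> and at most
          \<open>t + 1\<close> lose it, so the union gains \<open>z\<close> without losing
          \<open>x\<close>.\<close>
        then have "0 < deg S' I x" using degs(1)[of I] x(3) by simp
        moreover have "0 < deg S' I z"
          using degs(3)[of I] KI fin finite_subset[OF KI] by (simp add: KI' card_gt_0_iff K_def)
        ultimately have "y \<in> \<Union>(S' ` I) \<longleftrightarrow> y \<in> insert z (\<Union>(S ` I))" for y
          using degs(4)[of I y] deg_pos_iff[OF fin(1), of S y] deg_pos_iff[OF fin(1), of S' y] x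
          by (cases "y = x"; cases "y = z") auto
        then have U': "\<Union>(S' ` I) = insert z (\<Union>(S ` I))" by blast
        have "card (\<Union>(S' ` I)) = Suc (card (\<Union>(S ` I)))"
          unfolding U' using z(2) finite_subset[OF SP fin(2)] by simp
        then have k': "card I * (card P + 1) - card (\<Union>(S' ` I)) = k" using k n_def by linarith
        have "wins_within I \<eta> P t (card I * (card P + 1) - card (\<Union>(S' ` I))) S'"
        proof (rule less.hyps)
          show "card I * (card P + 1) - card (\<Union>(S' ` I)) < card I * (card P + 1) - card (\<Union>(S ` I))"
            unfolding k' using k n_def by simp
          show "\<Union>(S' ` I) \<subseteq> P" unfolding U' using SP z by simp
        qed (use fin pot cond' in auto)
        then show ?thesis unfolding k' .
      qed
      ultimately have "wins_within I \<eta> P t (Suc k) S" unfolding wins_within.simps by blast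
      then show ?thesis using k unfolding n_def by simp
    qed
  qed
qed

theorem theorem4p3:
  fixes I :: "'i set" and S :: "'i \<Rightarrow> 'a set" and \<eta> :: "'i \<Rightarrow> nat"
    and P :: "'a set" and t :: nat
  assumes "finite I" and "\<And>i. i \<in> I \<Longrightarrow> finite (S i)"
    and "\<And>i. i \<in> I \<Longrightarrow> \<eta> i > 0"
    and "finite P" and "(\<Union>i\<in>I. S i) \<subseteq> P" and "card P \<ge> (\<Sum>i\<in>I. \<eta> i)"
    and "t \<in> {1..card I - 1}"
  shows "fixer_wins I \<eta> P t S \<longleftrightarrow>
    (\<forall>W\<subseteq>I. int (card (\<Union>i\<in>W. S i)) \<ge> int (\<Sum>i\<in>W. \<eta> i) - int (nu t S W))"
proof -
  have "(int (card (\<Union>i\<in>W. S i)) \<ge> int (\<Sum>i\<in>W. \<eta> i) - int (nu t S W)) \<longleftrightarrow>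
      sum \<eta> W \<le> total_capacity t P S W" if "W \<subseteq> I" for W
  proof -
    have "finite W" using that assms(1) by (rule finite_subset)
    moreover have "\<Union>(S ` W) \<subseteq> P" using that assms(5) by blast
    ultimately have "total_capacity t P S W = card (\<Union>(S ` W)) + nu t S W"
      by (rule total_capacity_eq[OF assms(4)])
    then show ?thesis by linarith
  qed
  moreover have "fixer_wins I \<eta> P t S \<longleftrightarrow> (\<forall>W\<subseteq>I. sum \<eta> W \<le> total_capacity t P S W)"
  proof
    assume win: "fixer_wins I \<eta> P t S"
    show "\<forall>W\<subseteq>I. sum \<eta> W \<le> total_capacity t P S W"
    proof (intro allI impI)
      fix W assume W: "W \<subseteq> I"
      then have "\<Union>(S ` W) \<subseteq> P" "0 < t" using assms(5,7) by auto
      then show "sum \<eta> W \<le> total_capacity t P S W"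
        using fixer_loses[OF assms(1) W assms(4)] win by (meson not_le)
    qed
  next
    assume "\<forall>W\<subseteq>I. sum \<eta> W \<le> total_capacity t P S W"
    then show "fixer_wins I \<eta> P t S"
      using wins_within_imp_fixer_wins[OF fixer_wins_within[OF assms(1,4,5,6)]] by blast
  qed
  ultimately show ?thesis by auto
qed

end
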